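(* Consider the path graph $P_n$ with Laplacian $L_n$, with $n$ sufficiently large. For $k<n$ and small $\epsilon>0$ let $\lambda_{\min}(k)$ denote the optimal (maximal over $S\subset\{1,\dots,n\}$ with $|S|=k$) smallest eigenvalue of the perturbed Laplacian $L_n+\epsilon\sum_{j\in S}e_je_j^T$. Then, up to second order approximation in $\epsilon$, $\lambda_{\min}(2)>2\,\lambda_{\min}(1)$.
   Context: $e_j$ denotes the $j$-th column of $I_n$. The Laplacian of $P_n$ is the tridiagonal matrix with diagonal $(1,2,\dots,2,1)$ and sub/super-diagonal entries $-1$. "Up to second order" means the comparison is between the Taylor expansions in $\epsilon$ truncated after the $\epsilon^2$ term. *)

theory Defs
  imports
    "Jordan_Normal_Form.Char_Poly"
    "HOL-Library.Landau_Symbols"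
begin

text \<open>The vertices of the path are indexed by \<open>0, \<dots>, n - 1\<close>.\<close>

definition path_laplacian :: "nat \<Rightarrow> real mat" where
  "path_laplacian n = mat n n (\<lambda>(i, j).
     if i = j then (if i = 0 \<or> i = n - 1 then 1 else 2)
     else if i = j + 1 \<or> j = i + 1 then - 1
     else 0)"

text \<open>Matrices of varying dimension do not form a commutative monoid, so the sum
  \<open>\<Sum>j\<in>S. e\<^sub>j e\<^sub>j\<^sup>T\<close> is written entrywise.\<close>

definition sum_unit_outer :: "nat \<Rightarrow> nat set \<Rightarrow> real mat" where
  "sum_unit_outer n S = mat n n (\<lambda>(a, b). \<Sum>j\<in>S. unit_vec n j $ a * unit_vec n j $ b)"

definition perturbed_laplacian :: "nat \<Rightarrow> nat set \<Rightarrow> real \<Rightarrow> real mat" where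
  "perturbed_laplacian n S \<epsilon> = path_laplacian n + \<epsilon> \<cdot>\<^sub>m sum_unit_outer n S"

definition smallest_eigenvalue :: "real mat \<Rightarrow> real" where
  "smallest_eigenvalue A = Min {x. eigenvalue A x}"

definition lambda_min :: "nat \<Rightarrow> nat \<Rightarrow> real \<Rightarrow> real" where
  "lambda_min n k \<epsilon> =
     Max ((\<lambda>S. smallest_eigenvalue (perturbed_laplacian n S \<epsilon>)) ` {S. S \<subseteq> {..<n} \<and> card S = k})"

text \<open>\<open>p\<close> is the Taylor expansion of \<open>f\<close> at \<open>0\<close> truncated after the quadratic term. It is one-sided
  because only perturbations with \<open>\<epsilon> > 0\<close> are considered.\<close>

definition second_order_expansion :: "(real \<Rightarrow> real) \<Rightarrow> real poly \<Rightarrow> bool" where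
  "second_order_expansion f p \<longleftrightarrow>
     degree p \<le> 2 \<and> (\<lambda>\<epsilon>. f \<epsilon> - poly p \<epsilon>) \<in> O[at_right 0](\<lambda>\<epsilon>. \<epsilon> ^ 3)"

lemma second_order_expansion_unique:
  assumes "second_order_expansion f p" "second_order_expansion f q"
  shows "p = q"
proof (rule ccontr)
  assume "p \<noteq> q"
  define r where "r = q - p"
  have r: "r \<noteq> 0" "degree r \<le> 2"
    using \<open>p \<noteq> q\<close> assms by (auto simp: r_def second_order_expansion_def intro: degree_diff_le)
  have "(\<lambda>\<epsilon>. (f \<epsilon> - poly p \<epsilon>) - (f \<epsilon> - poly q \<epsilon>)) \<in> O[at_right 0](\<lambda>\<epsilon>. \<epsilon> ^ 3)"
    using assms unfolding second_order_expansion_def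
    by (elim conjE, rule_tac sum_in_bigo(2)[where f = "\<lambda>\<epsilon>. f \<epsilon> - poly p \<epsilon>"])
  then have bigo: "(\<lambda>\<epsilon>. poly r \<epsilon>) \<in> O[at_right 0](\<lambda>\<epsilon>. \<epsilon> ^ 3)"
    unfolding r_def poly_diff by simp
  obtain s where s: "r = [:- 0, 1:] ^ order 0 r * s" "\<not> [:- 0, 1:] dvd s"
    using order_decomp[OF r(1), of 0] by auto
  define m where "m = order 0 r"
  have m: "m \<le> 2" using order_degree[OF r(1), of 0] r(2) by (simp add: m_def)
  have s0: "poly s 0 \<noteq> 0" using s(2) by (simp add: poly_eq_0_iff_dvd)
  have pr: "poly r x = x ^ m * poly s x" for x
    by (subst s(1)) (simp add: m_def)
  obtain c where c: "eventually (\<lambda>x. norm (poly r x) \<le> c * norm (x ^ 3)) (at_right 0)"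
    using bigo by (elim landau_o.bigE)
  have "eventually (\<lambda>x::real. x > 0) (at_right 0)"
    by (simp add: eventually_at_right_less)
  with c have ev: "eventually (\<lambda>x. \<bar>poly s x\<bar> \<le> c * x ^ (3 - m)) (at_right 0)"
  proof eventually_elim
    case (elim x)
    have "x ^ 3 = x ^ m * x ^ (3 - m)" using m by (simp flip: power_add)
    then have "x ^ m * \<bar>poly s x\<bar> \<le> x ^ m * (c * x ^ (3 - m))"
      using elim by (simp add: pr abs_mult mult_ac)
    then show ?case using elim by simp
  qed
  have l1: "((\<lambda>x. \<bar>poly s x\<bar>) \<longlongrightarrow> \<bar>poly s 0\<bar>) (at_right 0)"
    by (intro tendsto_intros)
  have "((\<lambda>x::real. c * x ^ (3 - m)) \<longlongrightarrow> c * 0 ^ (3 - m)) (at_right 0)"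
    by (intro tendsto_intros)
  from tendsto_le[OF _ this l1 ev] s0 m show False
    by (simp add: power_0_left split: if_splits)
qed

end

theory Submission imports Defs begin

text \<open>Solve the eigenvalue equation of \<open>L\<^sub>n + \<epsilon> \<Sum>j\<in>S. e\<^sub>j e\<^sub>j\<^sup>T\<close> by shooting from the left end of the path,
  starting with the value \<open>1\<close>. The result is an eigenvector exactly if the flux out of the right end
  vanishes. For \<open>\<lambda> = k/n \<epsilon> - E/n \<epsilon>\<^sup>2 + c \<epsilon>\<^sup>3\<close>, where \<open>E\<close> is the sum over all edges of the squared
  first-order flux \<open>|S \<inter> {..<m}| - k m / n\<close>, this flux is a polynomial in \<open>\<epsilon>\<close> starting with \<open>(A - n c) \<epsilon>\<^sup>3\<close>.
  The intermediate value theorem therefore gives an eigenvalue within \<open>O(\<epsilon>\<^sup>3)\<close>; its eigenvector is close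
  to the all-ones vector, hence positive, and an eigenvalue of a matrix with nonpositive off-diagonal
  entries that has a positive eigenvector is the smallest one. The first-order terms for \<open>k = 2\<close> and twice
  \<open>k = 1\<close> agree, while the minimal \<open>E\<close> is about \<open>n / 12\<close> for both values of \<open>k\<close>.\<close>

section \<open>Positive eigenvectors\<close>

text \<open>Perron-Frobenius comparison: the least multiple \<open>t\<close> of \<open>v\<close>
  dominating an eigenvector \<open>y\<close> touches it at some index \<open>i\<close>. Since
  \<open>t v - y\<close> is nonnegative and vanishes at \<open>i\<close>, the off-diagonal signs
  make row \<open>i\<close> of \<open>A (t v - y)\<close> nonpositive, and this row equals
  \<open>(r - x) t v_i\<close>.\<close>

lemma positive_eigenvector_imp_le:
  fixes A :: "real mat"
  assumes A: "A \<in> carrier_mat n n"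
    and off: "\<And>i j. i < n \<Longrightarrow> j < n \<Longrightarrow> i \<noteq> j \<Longrightarrow> A $$ (i, j) \<le> 0"
    and v: "v \<in> carrier_vec n" "A *\<^sub>v v = r \<cdot>\<^sub>v v"
    and pos: "\<And>i. i < n \<Longrightarrow> v $ i > 0"
    and x: "eigenvalue A x"
  shows "r \<le> x"
proof -
  obtain y0 where y0: "y0 \<in> carrier_vec n" "y0 \<noteq> 0\<^sub>v n" "A *\<^sub>v y0 = x \<cdot>\<^sub>v y0"
    using x A unfolding eigenvalue_def eigenvector_def by auto
  have rowv: "(\<Sum>j<n. A $$ (i, j) * v $ j) = r * v $ i" if "i < n" for i
    using arg_cong[OF v(2), of "\<lambda>z. z $ i"] that A v(1)
    by (simp add: scalar_prod_def atLeast0LessThan)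
  have rowy0: "(\<Sum>j<n. A $$ (i, j) * y0 $ j) = x * y0 $ i" if "i < n" for i
    using arg_cong[OF y0(3), of "\<lambda>z. z $ i"] that A y0(1)
    by (simp add: scalar_prod_def atLeast0LessThan)
  obtain i0 where i0: "i0 < n" "y0 $ i0 \<noteq> 0"
    using y0(1,2) by (metis carrier_vecD eq_vecI index_zero_vec)
  \<comment> \<open>The sign makes one entry of \<open>y\<close> positive, which forces
    \<open>t > 0\<close>.\<close>
  define y where "y j = sgn (y0 $ i0) * y0 $ j" for j
  have rowy: "(\<Sum>j<n. A $$ (i, j) * y j) = x * y i" if "i < n" for i
    using arg_cong[OF rowy0[OF that], of "\<lambda>z. sgn (y0 $ i0) * z"]
    by (simp add: y_def sum_distrib_left mult_ac)
  have yi0: "y i0 > 0" using i0 by (simp add: y_def sgn_if)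
  define t where "t = Max ((\<lambda>j. y j / v $ j) ` {..<n})"
  have "t \<in> (\<lambda>j. y j / v $ j) ` {..<n}"
    unfolding t_def using i0 by (intro Max_in) auto
  then obtain i where i: "i < n" "t = y i / v $ i" by auto
  have t: "y j \<le> t * v $ j" if "j < n" for j
  proof -
    have "y j / v $ j \<le> t" unfolding t_def using that by (intro Max_ge) auto
    then show ?thesis using pos[OF that] by (simp add: field_simps)
  qed
  have tpos: "t > 0"
    using t[OF i0(1)] yi0 pos[OF i0(1)] by (meson less_le_trans zero_less_mult_pos2)
  have yi: "y i = t * v $ i" using i pos[OF i(1)] by simp
  have "(\<Sum>j<n. A $$ (i, j) * (t * v $ j - y j)) \<le> 0"
  proof (rule sum_nonpos)
    fix j assume j: "j \<in> {..<n}"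
    show "A $$ (i, j) * (t * v $ j - y j) \<le> 0"
      using off[OF i(1), of j] t[of j] j yi
      by (cases "j = i") (auto intro!: mult_nonpos_nonneg)
  qed
  then have "t * (\<Sum>j<n. A $$ (i, j) * v $ j) \<le> (\<Sum>j<n. A $$ (i, j) * y j)"
    by (simp add: right_diff_distrib sum_subtractf sum_distrib_left mult_ac)
  then have "t * (r * v $ i) \<le> x * (t * v $ i)"
    using rowv[OF i(1)] rowy[OF i(1)] yi by simp
  then have "r * (t * v $ i) \<le> x * (t * v $ i)" by (simp add: mult_ac)
  then show ?thesis using tpos pos[OF i(1)] by (simp add: mult_le_cancel_right)
qed

lemma smallest_eigenvalue_eqI:
  assumes A: "A \<in> carrier_mat n n" and n: "n > 0"
    and off: "\<And>i j. i < n \<Longrightarrow> j < n \<Longrightarrow> i \<noteq> j \<Longrightarrow> A $$ (i, j) \<le> 0"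
    and v: "v \<in> carrier_vec n" "A *\<^sub>v v = r \<cdot>\<^sub>v v"
    and pos: "\<And>i. i < n \<Longrightarrow> v $ i > 0"
  shows "smallest_eigenvalue A = r"
  unfolding smallest_eigenvalue_def
proof (rule Min_eqI)
  have "char_poly A \<noteq> 0" using degree_monic_char_poly[OF A] by auto
  then show "finite {x. eigenvalue A x}"
    using poly_roots_finite[of "char_poly A"] by (simp add: eigenvalue_root_char_poly[OF A])
  have "v \<noteq> 0\<^sub>v n" using pos[OF n] n by auto
  then show "r \<in> {x. eigenvalue A x}"
    using A v unfolding eigenvalue_def eigenvector_def by auto
  show "r \<le> x" if "x \<in> {x. eigenvalue A x}" for x
    using positive_eigenvector_imp_le[OF A off v pos] that by auto
qed

section \<open>Shooting along the path\<close>

text \<open>The second-order eigenvector recurrence as a first-order system: \<open>flux s i\<close>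
  is the increment of \<open>shoot s\<close> from \<open>i - 1\<close> to \<open>i\<close>, and
  \<open>s i\<close> is the diagonal perturbation at \<open>i\<close> minus the eigenvalue. The
  start \<open>flux s 0 = 0\<close> is the free left end. Working over any commutative ring lets the
  same recursion run over reals and over polynomials in \<epsilon>.\<close>

fun shoot :: "(nat \<Rightarrow> 'a::comm_ring_1) \<Rightarrow> nat \<Rightarrow> 'a" and flux :: "(nat \<Rightarrow> 'a) \<Rightarrow> nat \<Rightarrow> 'a" where
  "shoot s 0 = 1"
| "shoot s (Suc i) = shoot s i + (flux s i + s i * shoot s i)"
| "flux s 0 = 0"
| "flux s (Suc i) = flux s i + s i * shoot s i"

text \<open>Evaluation is a ring homomorphism, so it commutes with the recursion; Taylor
  coefficients in \<epsilon> can then be computed formally.\<close>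

lemma poly_shoot_flux:
  "poly (shoot s i) x = shoot (\<lambda>j. poly (s j) x) i \<and> poly (flux s i) x = flux (\<lambda>j. poly (s j) x) i"
  by (induction i) auto

lemma continuous_on_shoot_flux:
  fixes s :: "'b::topological_space \<Rightarrow> nat \<Rightarrow> real"
  assumes "\<And>j. continuous_on X (\<lambda>x. s x j)"
  shows "continuous_on X (\<lambda>x. shoot (s x) i) \<and> continuous_on X (\<lambda>x. flux (s x) i)"
  by (induction i) (auto intro!: continuous_intros assms)

text \<open>With all shifts zero the solution is the all-ones vector; this limit yields positivity
  of the eigenvector for small \<epsilon>.\<close>

lemma tendsto_shoot_flux:
  fixes s :: "'b \<Rightarrow> nat \<Rightarrow> real"
  assumes "\<And>j. ((\<lambda>x. s x j) \<longlongrightarrow> 0) F"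
  shows "((\<lambda>x. shoot (s x) i) \<longlongrightarrow> 1) F \<and> ((\<lambda>x. flux (s x) i) \<longlongrightarrow> 0) F"
proof (induction i)
  case (Suc i)
  then have "((\<lambda>x. shoot (s x) i + (flux (s x) i + s x i * shoot (s x) i)) \<longlongrightarrow> 1 + (0 + 0 * 1)) F"
    "((\<lambda>x. flux (s x) i + s x i * shoot (s x) i) \<longlongrightarrow> 0 + 0 * 1) F"
    by (intro tendsto_add tendsto_mult assms; simp)+
  then show ?case by simp
qed auto

section \<open>Matrix rows in terms of the recursion\<close>

lemma sum_tridiagonal:
  fixes x :: "nat \<Rightarrow> real"
  assumes "i < n"
  shows "(\<Sum>j<n. (if i = j then a else if i = j + 1 \<or> j = i + 1 then - 1 else 0) * x j) =
    a * x i - (if i = 0 then 0 else x (i - 1)) - (if i + 1 < n then x (i + 1) else 0)"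
proof -
  \<comment> \<open>For \<open>i = 0\<close> truncated subtraction makes \<open>i - 1\<close> equal
    to \<open>i\<close>, hence the guard inside the second delta term.\<close>
  have "(\<Sum>j<n. (if i = j then a else if i = j + 1 \<or> j = i + 1 then - 1 else 0) * x j) =
    (\<Sum>j<n. (if j = i then a * x j else 0) - (if j = i - 1 then (if i = 0 then 0 else x j) else 0)
       - (if j = i + 1 then x j else 0))"
    by (intro sum.cong) auto
  also have "\<dots> = a * x i - (if i = 0 then 0 else x (i - 1)) - (if i + 1 < n then x (i + 1) else 0)"
    using assms by (simp add: sum_subtractf sum.delta)
  finally show ?thesis .
qed

lemma perturbed_laplacian_index:
  assumes "i < n" "j < n" "S \<subseteq> {..<n}"
  shows "perturbed_laplacian n S \<epsilon> $$ (i, j) =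
    (if i = j then (if i = 0 \<or> i = n - 1 then 1 else 2) + \<epsilon> * of_bool (i \<in> S)
     else if i = j + 1 \<or> j = i + 1 then - 1 else 0)"
proof -
  have fin: "finite S" using assms finite_subset by blast
  have "(\<Sum>k\<in>S. unit_vec n k $ i * unit_vec n k $ j :: real) =
    (\<Sum>k\<in>S. if k = i then of_bool (i = j) else 0)"
    using assms by (intro sum.cong) (auto simp: unit_vec_def)
  also have "\<dots> = of_bool (i = j \<and> i \<in> S)" using fin by (simp add: sum.delta)
  finally show ?thesis
    using assms by (simp add: perturbed_laplacian_def path_laplacian_def sum_unit_outer_def)
qed

lemma perturbed_laplacian_carrier: "perturbed_laplacian n S \<epsilon> \<in> carrier_mat n n"
  by (simp add: perturbed_laplacian_def path_laplacian_def sum_unit_outer_def)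

text \<open>All rows but the last hold by construction of the recursion. The last row has diagonal 1
  rather than 2, so it asks that no increment leaves the right end, which is
  \<open>flux s n = 0\<close>.\<close>

lemma perturbed_laplacian_shoot:
  assumes n: "n \<ge> 2" and S: "S \<subseteq> {..<n}"
    and s: "s = (\<lambda>i. \<epsilon> * of_bool (i \<in> S) - r)" and root: "flux s n = 0"
  shows "perturbed_laplacian n S \<epsilon> *\<^sub>v vec n (shoot s) = r \<cdot>\<^sub>v vec n (shoot s)"
proof (rule eq_vecI)
  let ?A = "perturbed_laplacian n S \<epsilon>"
  show "dim_vec (?A *\<^sub>v vec n (shoot s)) = dim_vec (r \<cdot>\<^sub>v vec n (shoot s))"
    using perturbed_laplacian_carrier[of n S \<epsilon>] by auto
  fix i assume "i < dim_vec (r \<cdot>\<^sub>v vec n (shoot s))"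
  then have i: "i < n" by simp
  have "(?A *\<^sub>v vec n (shoot s)) $ i = (\<Sum>j<n. ?A $$ (i, j) * shoot s j)"
    using i perturbed_laplacian_carrier[of n S \<epsilon>]
    by (simp add: scalar_prod_def atLeast0LessThan)
  also have "\<dots> = (\<Sum>j<n. (if i = j then (if i = 0 \<or> i = n - 1 then 1 else 2) + \<epsilon> * of_bool (i \<in> S)
     else if i = j + 1 \<or> j = i + 1 then - 1 else 0) * shoot s j)"
    using i S by (intro sum.cong) (simp_all add: perturbed_laplacian_index)
  also have "\<dots> = ((if i = 0 \<or> i = n - 1 then 1 else 2) + \<epsilon> * of_bool (i \<in> S)) * shoot s i
      - (if i = 0 then 0 else shoot s (i - 1)) - (if i + 1 < n then shoot s (i + 1) else 0)"
    by (rule sum_tridiagonal[OF i])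
  also have "\<dots> = r * shoot s i"
  proof -
    have si: "\<epsilon> * of_bool (i \<in> S) = s i + r" by (simp add: s)
    have prev: "(if i = 0 then 0 else shoot s (i - 1)) = (if i = 0 then 0 else shoot s i - flux s i)"
      by (cases i) auto
    have last: "flux s i + s i * shoot s i = 0" if "i = n - 1"
      using root that n by (cases n) auto
    show ?thesis
      unfolding si prev using last n i by (cases "i = n - 1") (auto simp: algebra_simps)
  qed
  finally show "(?A *\<^sub>v vec n (shoot s)) $ i = (r \<cdot>\<^sub>v vec n (shoot s)) $ i"
    using i by simp
qed

lemma smallest_eigenvalue_shoot:
  assumes n: "n \<ge> 2" and S: "S \<subseteq> {..<n}"
    and s: "s = (\<lambda>i. \<epsilon> * of_bool (i \<in> S) - r)" and root: "flux s n = 0"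
    and pos: "\<And>i. i < n \<Longrightarrow> shoot s i > 0"
  shows "smallest_eigenvalue (perturbed_laplacian n S \<epsilon>) = r"
  by (rule smallest_eigenvalue_eqI[OF perturbed_laplacian_carrier _ _ _
        perturbed_laplacian_shoot[OF n S s root]])
    (use n S pos in \<open>auto simp: perturbed_laplacian_index\<close>)

section \<open>Expansion of the smallest eigenvalue\<close>

definition cut_flux :: "nat \<Rightarrow> nat set \<Rightarrow> nat \<Rightarrow> real" where
  "cut_flux n S m = real (card (S \<inter> {..<m})) - real (card S) * real m / real n"

text \<open>For \<open>S \<subseteq> {..<n}\<close> the terms at \<open>0\<close> and
  \<open>n\<close> vanish, so the sum runs effectively over the \<open>n - 1\<close> edges.\<close>

definition energy :: "nat \<Rightarrow> nat set \<Rightarrow> real" where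
  "energy n S = (\<Sum>m\<le>n. (cut_flux n S m)\<^sup>2)"

lemma cut_flux_0 [simp]: "cut_flux n S 0 = 0"
  by (simp add: cut_flux_def)

lemma cut_flux_Suc:
  "cut_flux n S (Suc i) = cut_flux n S i + (of_bool (i \<in> S) - real (card S) / real n)"
proof -
  have "S \<inter> {..<Suc i} = (if i \<in> S then insert i (S \<inter> {..<i}) else S \<inter> {..<i})"
    by (auto simp: less_Suc_eq)
  then show ?thesis by (simp add: cut_flux_def field_simps add_divide_distrib)
qed

lemma cut_flux_end: "S \<subseteq> {..<n} \<Longrightarrow> n > 0 \<Longrightarrow> cut_flux n S n = 0"
  by (simp add: cut_flux_def Int_absorb2)

text \<open>The quantity \<open>\<epsilon> \<cdot> of_bool (i \<in> S) - \<lambda>\<close> as a polynomial in \<open>\<epsilon>\<close>, with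
  \<open>\<lambda> = k/n \<epsilon> - E/n \<epsilon>\<^sup>2 + c \<epsilon>\<^sup>3\<close>.\<close>

definition shift_poly :: "nat \<Rightarrow> nat set \<Rightarrow> real \<Rightarrow> nat \<Rightarrow> real poly" where
  "shift_poly n S c i =
     [:0, of_bool (i \<in> S) - real (card S) / real n, energy n S / real n, - c:]"

lemma coeff_shift_poly_mult:
  "coeff (shift_poly n S c i * q) 0 = 0"
  "coeff (shift_poly n S c i * q) 1 = (of_bool (i \<in> S) - real (card S) / real n) * coeff q 0"
  "coeff (shift_poly n S c i * q) 2 = (of_bool (i \<in> S) - real (card S) / real n) * coeff q 1
     + energy n S / real n * coeff q 0"
  "coeff (shift_poly n S c i * q) 3 = (of_bool (i \<in> S) - real (card S) / real n) * coeff q 2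
     + energy n S / real n * coeff q 1 - c * coeff q 0"
  by (simp_all add: shift_poly_def numeral_2_eq_2 numeral_3_eq_3 coeff_pCons)

text \<open>The quadratic coefficient is a summation by parts: each step adds the increment of
  \<open>cut_flux\<close> times the partial sum of \<open>cut_flux\<close>, plus
  \<open>energy n S / n\<close>. At \<open>i = n\<close> the boundary term vanishes and the two
  energy contributions cancel, which is what fixes the quadratic coefficient of the
  eigenvalue.\<close>

lemma coeff_shoot_flux:
  fixes n S c
  defines "s \<equiv> shift_poly n S c"
  shows "coeff (shoot s i) 0 = 1 \<and> coeff (flux s i) 0 = 0
    \<and> coeff (flux s i) 1 = cut_flux n S i \<and> coeff (shoot s i) 1 = (\<Sum>m\<le>i. cut_flux n S m)
    \<and> coeff (flux s i) 2 = cut_flux n S i * (\<Sum>m\<le>i. cut_flux n S m)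
        - (\<Sum>m\<le>i. (cut_flux n S m)\<^sup>2) + real i * (energy n S / real n)"
proof (induction i)
  case (Suc i)
  then show ?case
    by (simp add: s_def coeff_shift_poly_mult cut_flux_Suc algebra_simps add_divide_distrib
        power2_eq_square del: One_nat_def)
qed (simp_all add: s_def)

text \<open>Each step feeds \<open>c\<close> into order three only through the constant coefficient
  1 of \<open>shoot\<close>, so every step contributes \<open>- c\<close>. Varying \<open>c\<close>
  thus gives the leading term of the end flux either sign.\<close>

lemma coeff_shoot_flux_cubic:
  "coeff (shoot (shift_poly n S c) i) 2 = coeff (shoot (shift_poly n S 0) i) 2
    \<and> coeff (flux (shift_poly n S c) i) 2 = coeff (flux (shift_poly n S 0) i) 2
    \<and> coeff (flux (shift_poly n S c) i) 3 = coeff (flux (shift_poly n S 0) i) 3 - real i * c"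
proof (induction i)
  case (Suc i)
  then show ?case
    using coeff_shoot_flux[of n S c i] coeff_shoot_flux[of n S 0 i]
    by (simp add: coeff_shift_poly_mult algebra_simps del: One_nat_def)
qed auto

lemma poly_eventually_pos_at_right:
  fixes P :: "real poly"
  assumes "coeff P 0 = 0" "coeff P 1 = 0" "coeff P 2 = 0" "coeff P 3 > 0"
  shows "\<forall>\<^sub>F x in at_right 0. poly P x > 0"
proof -
  obtain a b c Q where P: "P = pCons a (pCons b (pCons c Q))" by (metis pCons_cases)
  have Q: "a = 0" "b = 0" "c = 0" "poly Q 0 > 0"
    using assms by (simp_all add: P numeral_2_eq_2 numeral_3_eq_3 poly_0_coeff_0)
  have "((\<lambda>x. poly Q x) \<longlongrightarrow> poly Q 0) (at_right 0)" by (intro tendsto_intros)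
  then have "\<forall>\<^sub>F x in at_right 0. poly Q x > 0" using Q(4) by (rule order_tendstoD)
  then show ?thesis using eventually_at_right_less[of 0]
    by eventually_elim (simp add: P Q)
qed

lemma smallest_eigenvalue_expansion:
  assumes n: "n \<ge> 2" and S: "S \<subseteq> {..<n}"
  shows "second_order_expansion (\<lambda>\<epsilon>. smallest_eigenvalue (perturbed_laplacian n S \<epsilon>))
    [:0, real (card S) / real n, - energy n S / real n:]"
proof -
  define p where "p = [:0, real (card S) / real n, - energy n S / real n:]"
  define \<phi> where "\<phi> \<epsilon> r = flux (\<lambda>i. \<epsilon> * of_bool (i \<in> S) - r) n" for \<epsilon> r :: real
  define A where "A = coeff (flux (shift_poly n S 0) n) 3"
  \<comment> \<open>Large enough that the cubic coefficient \<open>A - n c\<close> is negative at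
    \<open>c = C\<close> and positive at \<open>c = - C\<close>; these two choices bracket a
    root.\<close>
  define C where "C = \<bar>A\<bar> + 1"
  have C: "C > 0" "A - n * C < 0" "A - n * (- C) > 0"
  proof -
    have "real n * C \<ge> 1 * C" using n by (intro mult_right_mono) (auto simp: C_def)
    moreover have "\<bar>A\<bar> < C" by (simp add: C_def)
    ultimately show "C > 0" "A - n * C < 0" "A - n * (- C) > 0" by auto
  qed
  have \<phi>_poly: "\<phi> \<epsilon> (poly p \<epsilon> + c * \<epsilon> ^ 3) = poly (flux (shift_poly n S c) n) \<epsilon>" for \<epsilon> c
    unfolding \<phi>_def poly_shoot_flux[THEN conjunct2]
    by (rule arg_cong[where f = "\<lambda>s. flux s n"])
      (auto simp: shift_poly_def p_def fun_eq_iff algebra_simps power3_eq_cube)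
  have low: "coeff (flux (shift_poly n S c) n) 0 = 0" "coeff (flux (shift_poly n S c) n) 1 = 0"
    "coeff (flux (shift_poly n S c) n) 2 = 0" for c
    using coeff_shoot_flux[of n S c n] cut_flux_end[OF S] n by (auto simp: energy_def)
  have cubic: "coeff (flux (shift_poly n S c) n) 3 = A - n * c" for c :: real
    using coeff_shoot_flux_cubic[of n S c n] by (simp add: A_def)
  have "\<forall>\<^sub>F \<epsilon> in at_right 0. poly (flux (shift_poly n S (- C)) n) \<epsilon> > 0"
    using low cubic C by (intro poly_eventually_pos_at_right) auto
  moreover have "\<forall>\<^sub>F \<epsilon> in at_right 0. poly (- flux (shift_poly n S C) n) \<epsilon> > 0"
    using low cubic C by (intro poly_eventually_pos_at_right) auto
  ultimately have ex: "\<forall>\<^sub>F \<epsilon> in at_right 0. \<exists>r. \<bar>r - poly p \<epsilon>\<bar> \<le> C * \<epsilon> ^ 3 \<and> \<phi> \<epsilon> r = 0"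
    using eventually_at_right_less[of 0]
  proof eventually_elim
    case (elim \<epsilon>)
    have "\<exists>r. poly p \<epsilon> - C * \<epsilon> ^ 3 \<le> r \<and> r \<le> poly p \<epsilon> + C * \<epsilon> ^ 3 \<and> \<phi> \<epsilon> r = 0"
    proof (rule IVT2')
      show "\<phi> \<epsilon> (poly p \<epsilon> + C * \<epsilon> ^ 3) \<le> 0" using elim \<phi>_poly[of \<epsilon> C] by simp
      show "0 \<le> \<phi> \<epsilon> (poly p \<epsilon> - C * \<epsilon> ^ 3)" using elim \<phi>_poly[of \<epsilon> "- C"] by simp
      show "poly p \<epsilon> - C * \<epsilon> ^ 3 \<le> poly p \<epsilon> + C * \<epsilon> ^ 3" using elim C(1) by simp
      show "continuous_on {poly p \<epsilon> - C * \<epsilon> ^ 3..poly p \<epsilon> + C * \<epsilon> ^ 3} (\<phi> \<epsilon>)"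
        unfolding \<phi>_def
        by (rule continuous_on_shoot_flux[THEN conjunct2]) (intro continuous_intros)
    qed
    then obtain r where "poly p \<epsilon> - C * \<epsilon> ^ 3 \<le> r" "r \<le> poly p \<epsilon> + C * \<epsilon> ^ 3" "\<phi> \<epsilon> r = 0"
      by blast
    then show ?case by (intro exI[of _ r]) (simp add: abs_le_iff)
  qed
  \<comment> \<open>The root is chosen separately for each \<epsilon>; the bound around
    \<open>p\<close> alone gives its convergence to 0.\<close>
  define R where "R \<epsilon> = (SOME r. \<bar>r - poly p \<epsilon>\<bar> \<le> C * \<epsilon> ^ 3 \<and> \<phi> \<epsilon> r = 0)" for \<epsilon>
  have R: "\<forall>\<^sub>F \<epsilon> in at_right 0. \<bar>R \<epsilon> - poly p \<epsilon>\<bar> \<le> C * \<epsilon> ^ 3 \<and> \<phi> \<epsilon> (R \<epsilon>) = 0"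
    using ex unfolding R_def by eventually_elim (rule someI_ex)
  have "((\<lambda>\<epsilon>. \<epsilon> ^ 3) \<longlongrightarrow> 0 ^ 3) (at_right (0::real))" by (intro tendsto_intros)
  moreover have "\<forall>\<^sub>F \<epsilon> in at_right 0. norm (R \<epsilon> - poly p \<epsilon>) \<le> norm (\<epsilon> ^ 3) * C"
    using R eventually_at_right_less[of 0] by eventually_elim (simp add: mult.commute)
  ultimately have "((\<lambda>\<epsilon>. R \<epsilon> - poly p \<epsilon>) \<longlongrightarrow> 0) (at_right 0)"
    by (simp add: tendsto_0_le[where f = "\<lambda>\<epsilon>. \<epsilon> ^ 3" and K = C])
  moreover have "((\<lambda>\<epsilon>. poly p \<epsilon>) \<longlongrightarrow> poly p 0) (at_right 0)" by (intro tendsto_intros)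
  ultimately have "((\<lambda>\<epsilon>. (R \<epsilon> - poly p \<epsilon>) + poly p \<epsilon>) \<longlongrightarrow> 0 + poly p 0) (at_right 0)"
    by (rule tendsto_add)
  then have R0: "(R \<longlongrightarrow> 0) (at_right 0)" by (simp add: p_def)
  \<comment> \<open>All shifts tend to 0, so each of the finitely many entries tends to 1. For small
    \<epsilon> the eigenvector is positive and \<open>R\<close> is the smallest eigenvalue.\<close>
  have "((\<lambda>\<epsilon>. \<epsilon> * of_bool (j \<in> S) - R \<epsilon>) \<longlongrightarrow> 0 * of_bool (j \<in> S) - 0) (at_right 0)" for j
    by (intro tendsto_intros R0)
  then have "((\<lambda>\<epsilon>. shoot (\<lambda>j. \<epsilon> * of_bool (j \<in> S) - R \<epsilon>) i) \<longlongrightarrow> 1) (at_right 0)" for i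
    by (intro tendsto_shoot_flux[THEN conjunct1]) simp
  then have "\<forall>\<^sub>F \<epsilon> in at_right 0. 0 < shoot (\<lambda>j. \<epsilon> * of_bool (j \<in> S) - R \<epsilon>) i" for i
    by (rule order_tendstoD(1)) simp
  then have "\<forall>\<^sub>F \<epsilon> in at_right 0. \<forall>i\<in>{..<n}. 0 < shoot (\<lambda>j. \<epsilon> * of_bool (j \<in> S) - R \<epsilon>) i"
    by (simp add: eventually_ball_finite)
  then have "\<forall>\<^sub>F \<epsilon> in at_right 0.
      norm (smallest_eigenvalue (perturbed_laplacian n S \<epsilon>) - poly p \<epsilon>) \<le> C * norm (\<epsilon> ^ 3)"
    using R eventually_at_right_less[of 0]
  proof eventually_elim
    case (elim \<epsilon>)
    then have "smallest_eigenvalue (perturbed_laplacian n S \<epsilon>) = R \<epsilon>"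
      by (intro smallest_eigenvalue_shoot[OF n S refl]) (auto simp: \<phi>_def)
    then show ?case using elim by simp
  qed
  then have "(\<lambda>\<epsilon>. smallest_eigenvalue (perturbed_laplacian n S \<epsilon>) - poly p \<epsilon>) \<in> O[at_right 0](\<lambda>\<epsilon>. \<epsilon> ^ 3)"
    by (rule bigoI)
  then show ?thesis by (simp add: second_order_expansion_def p_def)
qed

section \<open>Maximum over finitely many vertex sets\<close>

text \<open>The linear terms agree, so an index \<open>m\<close> maximizing \<open>e\<close> has the
  largest quadratic polynomial at every \<epsilon>. The maximum is squeezed between
  \<open>f m\<close> and that polynomial plus the error, whose constant is uniform because
  \<open>I\<close> is finite.\<close>

lemma second_order_expansion_Max:
  assumes fin: "finite I" "I \<noteq> {}"
    and f: "\<And>i. i \<in> I \<Longrightarrow> second_order_expansion (f i) [:0, a, e i:]"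
  shows "second_order_expansion (\<lambda>\<epsilon>. Max ((\<lambda>i. f i \<epsilon>) ` I)) [:0, a, Max (e ` I):]"
proof -
  have "\<exists>c. \<forall>\<^sub>F \<epsilon> in at_right 0. \<bar>f i \<epsilon> - poly [:0, a, e i:] \<epsilon>\<bar> \<le> c * \<bar>\<epsilon> ^ 3\<bar>" if "i \<in> I" for i
    using f[OF that] unfolding second_order_expansion_def
    by (elim conjE landau_o.bigE) (auto simp: real_norm_def)
  then obtain c where c: "\<And>i. i \<in> I \<Longrightarrow>
      \<forall>\<^sub>F \<epsilon> in at_right 0. \<bar>f i \<epsilon> - poly [:0, a, e i:] \<epsilon>\<bar> \<le> c i * \<bar>\<epsilon> ^ 3\<bar>"
    by metis
  define C where "C = Max (c ` I)"
  have "Max (e ` I) \<in> e ` I" using fin by (intro Max_in) auto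
  then obtain m where m: "m \<in> I" "Max (e ` I) = e m" by auto
  have "\<forall>\<^sub>F \<epsilon> in at_right 0. \<forall>i\<in>I. \<bar>f i \<epsilon> - poly [:0, a, e i:] \<epsilon>\<bar> \<le> c i * \<bar>\<epsilon> ^ 3\<bar>"
    using c fin by (simp add: eventually_ball_finite)
  then have "\<forall>\<^sub>F \<epsilon> in at_right 0.
      norm (Max ((\<lambda>i. f i \<epsilon>) ` I) - poly [:0, a, Max (e ` I):] \<epsilon>) \<le> C * norm (\<epsilon> ^ 3)"
  proof eventually_elim
    case (elim \<epsilon>)
    have err: "\<bar>f i \<epsilon> - poly [:0, a, e i:] \<epsilon>\<bar> \<le> C * \<bar>\<epsilon> ^ 3\<bar>" if "i \<in> I" for i
    proof -
      have "c i \<le> C" unfolding C_def using that fin by (intro Max_ge) auto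
      then have "c i * \<bar>\<epsilon> ^ 3\<bar> \<le> C * \<bar>\<epsilon> ^ 3\<bar>" by (intro mult_right_mono) auto
      then show ?thesis using elim that by force
    qed
    have le: "poly [:0, a, e i:] \<epsilon> \<le> poly [:0, a, e m:] \<epsilon>" if "i \<in> I" for i
    proof -
      have "e i \<le> e m" unfolding m(2)[symmetric] using that fin by (intro Max_ge) auto
      then have "e i * \<epsilon>\<^sup>2 \<le> e m * \<epsilon>\<^sup>2" by (intro mult_right_mono) auto
      then show ?thesis by (simp add: algebra_simps power2_eq_square)
    qed
    have "Max ((\<lambda>i. f i \<epsilon>) ` I) \<le> poly [:0, a, e m:] \<epsilon> + C * \<bar>\<epsilon> ^ 3\<bar>"
      using fin
    proof (intro Max.boundedI)
      fix y assume "y \<in> (\<lambda>i. f i \<epsilon>) ` I"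
      then obtain i where i: "i \<in> I" "y = f i \<epsilon>" by auto
      show "y \<le> poly [:0, a, e m:] \<epsilon> + C * \<bar>\<epsilon> ^ 3\<bar>"
        unfolding i(2) using err[OF i(1)] le[OF i(1)] by linarith
    qed auto
    moreover have "f m \<epsilon> \<le> Max ((\<lambda>i. f i \<epsilon>) ` I)" using fin m by (intro Max_ge) auto
    ultimately show ?case using err[OF m(1)] unfolding m(2) real_norm_def by linarith
  qed
  then show ?thesis unfolding second_order_expansion_def by (auto intro: bigoI)
qed

text \<open>The linear coefficient depends on \<open>S\<close> only through its size, so the
  quadratic term, that is, the minimal energy, decides.\<close>

lemma lambda_min_expansion:
  assumes "n \<ge> 2" "k \<le> n"
  shows "second_order_expansion (lambda_min n k)
    [:0, real k / real n, Max ((\<lambda>S. - energy n S / real n) ` {S. S \<subseteq> {..<n} \<and> card S = k}):]"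
  unfolding lambda_min_def
proof (rule second_order_expansion_Max)
  show "finite {S. S \<subseteq> {..<n} \<and> card S = k}" by simp
  have "{..<k} \<in> {S. S \<subseteq> {..<n} \<and> card S = k}" using assms by auto
  then show "{S. S \<subseteq> {..<n} \<and> card S = k} \<noteq> {}" by blast
  show "second_order_expansion (\<lambda>\<epsilon>. smallest_eigenvalue (perturbed_laplacian n S \<epsilon>))
      [:0, real k / real n, - energy n S / real n:]" if "S \<in> {S. S \<subseteq> {..<n} \<and> card S = k}" for S
    using smallest_eigenvalue_expansion[of n S] assms that by auto
qed

section \<open>Comparison of the energies\<close>

lemma sum_squares_atMost: "(\<Sum>m\<le>i. (real m)\<^sup>2) = real i * (real i + 1) * (2 * real i + 1) / 6"
  by (induction i) (simp_all add: power2_eq_square field_simps)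

lemma sum_squares_reflect:
  assumes "b < n"
  shows "(\<Sum>m\<in>{b<..n}. (real n - real m)\<^sup>2) = (\<Sum>m\<le>n - 1 - b. (real m)\<^sup>2)"
  by (rule sum.reindex_bij_witness[of _ "\<lambda>m. n - m" "\<lambda>m. n - m"]) (use assms in auto)

lemma sum_shifted_squares_atMost:
  fixes x :: real
  shows "(\<Sum>m\<le>i. (x - 2 * real m)\<^sup>2) =
    (real i + 1) * x\<^sup>2 - 2 * x * real i * (real i + 1) + 2 * real i * (real i + 1) * (2 * real i + 1) / 3"
  by (induction i) (simp_all add: power2_eq_square field_simps)

lemma energy_scaled:
  assumes "n > 0"
  shows "(real n)\<^sup>2 * energy n S =
    (\<Sum>m\<le>n. (real n * real (card (S \<inter> {..<m})) - real (card S) * real m)\<^sup>2)"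
  unfolding energy_def sum_distrib_left
  by (intro sum.cong refl) (use assms in \<open>simp add: cut_flux_def field_simps flip: power_mult_distrib\<close>)

text \<open>Convexity of the cube, made explicit by factoring the difference.\<close>

lemma cube_mean_le:
  fixes x y :: real
  assumes "x \<ge> 0" "y \<ge> 0"
  shows "(x + y) ^ 3 / 12 \<le> x ^ 3 / 3 + y ^ 3 / 3"
proof -
  have "x ^ 3 / 3 + y ^ 3 / 3 - (x + y) ^ 3 / 12 = (x + y) * (x - y)\<^sup>2 / 4"
    by (simp add: power3_eq_cube power2_eq_square field_simps)
  also have "\<dots> \<ge> 0" using assms by simp
  finally show ?thesis by simp
qed

text \<open>The scaled fluxes are \<open>- m\<close> up to \<open>s\<close> and \<open>n - m\<close>
  beyond it. Their squares sum to at least \<open>s^3/3 + b^3/3\<close>, where \<open>b\<close>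
  counts the vertices right of \<open>s\<close>; as \<open>s + b = n - 1\<close>, convexity makes
  the balanced split the worst case.\<close>

lemma energy_singleton_ge:
  assumes s: "s < n"
  shows "(real n)\<^sup>2 * energy n {s} \<ge> (real n - 1) ^ 3 / 12"
proof -
  have *: "{s} \<inter> {..<m} = (if s < m then {s} else {})" for m by auto
  define b where "b = n - 1 - s"
  have n: "real n - 1 = real s + real b" using s by (simp add: b_def of_nat_diff)
  have "(real n)\<^sup>2 * energy n {s} = (\<Sum>m\<le>n. (real n * (if s < m then 1 else 0) - real m)\<^sup>2)"
    using s by (subst energy_scaled) (auto simp: * intro!: sum.cong)
  also have "{..n} = {..s} \<union> {s<..n}" using s by auto
  also have "(\<Sum>m\<in>{..s} \<union> {s<..n}. (real n * (if s < m then 1 else 0) - real m)\<^sup>2) =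
    (\<Sum>m\<le>s. (real m)\<^sup>2) + (\<Sum>m\<in>{s<..n}. (real n - real m)\<^sup>2)"
    by (subst sum.union_disjoint) (auto intro!: arg_cong2[where f = "(+)"] sum.cong)
  also have "\<dots> = real s * (real s + 1) * (2 * real s + 1) / 6 + real b * (real b + 1) * (2 * real b + 1) / 6"
    using s by (simp add: sum_squares_reflect sum_squares_atMost b_def)
  also have "\<dots> \<ge> (real s) ^ 3 / 3 + (real b) ^ 3 / 3"
    by (simp add: power3_eq_cube field_simps)
  finally have "(real n)\<^sup>2 * energy n {s} \<ge> (real s) ^ 3 / 3 + (real b) ^ 3 / 3" .
  moreover have "(real s + real b) ^ 3 / 12 \<le> real s ^ 3 / 3 + real b ^ 3 / 3"
    by (rule cube_mean_le) simp_all
  ultimately show ?thesis unfolding n by (rule order_trans[rotated])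
qed

text \<open>The scaled fluxes are \<open>- 2 m\<close>, \<open>n - 2 m\<close> and
  \<open>2 (n - m)\<close> on the three stretches cut out by the pair; reflection identifies the two
  outer sums. The hypothesis on \<open>a\<close> separates the two vertices.\<close>

lemma energy_pair:
  assumes a: "2 * a + 1 < n"
  shows "(real n)\<^sup>2 * energy n {a, n - 1 - a} = 4 * real a * (real a + 1) * (2 * real a + 1) / 3
    + (\<Sum>m\<in>{a<..n - 1 - a}. (real n - 2 * real m)\<^sup>2)"
proof -
  define b where "b = n - 1 - a"
  have ab: "a < b" "b < n" using a by (auto simp: b_def)
  have *: "card ({a, b} \<inter> {..<m}) = (if m \<le> a then 0 else if m \<le> b then 1 else 2)" for m
  proof -
    have "{a, b} \<inter> {..<m} = (if m \<le> a then {} else if m \<le> b then {a} else {a, b})"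
      using ab by auto
    then show ?thesis using ab by simp
  qed
  define g where "g m = (real n * real (card ({a, b} \<inter> {..<m})) - real (card {a, b}) * real m)\<^sup>2" for m
  have "(real n)\<^sup>2 * energy n {a, b} = (\<Sum>m\<le>n. g m)"
    using ab unfolding g_def by (intro energy_scaled) auto
  also have "{..n} = {..a} \<union> ({a<..b} \<union> {b<..n})" using ab by auto
  also have "sum g ({..a} \<union> ({a<..b} \<union> {b<..n})) = sum g {..a} + (sum g {a<..b} + sum g {b<..n})"
    using ab by (simp add: sum.union_disjoint disjoint_iff)
  also have "sum g {..a} = 4 * (\<Sum>m\<le>a. (real m)\<^sup>2)"
    unfolding sum_distrib_left using ab
    by (intro sum.cong) (auto simp: g_def * power_mult_distrib)
  also have "sum g {a<..b} = (\<Sum>m\<in>{a<..b}. (real n - 2 * real m)\<^sup>2)"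
    using ab by (intro sum.cong) (auto simp: g_def *)
  also have "sum g {b<..n} = 4 * (\<Sum>m\<in>{b<..n}. (real n - real m)\<^sup>2)"
    unfolding sum_distrib_left using ab
    by (intro sum.cong) (auto simp: g_def * power2_eq_square algebra_simps)
  also have "(\<Sum>m\<in>{b<..n}. (real n - real m)\<^sup>2) = (\<Sum>m\<le>a. (real m)\<^sup>2)"
    using ab a by (simp add: sum_squares_reflect b_def)
  finally show ?thesis by (simp add: b_def sum_squares_atMost)
qed

text \<open>Near the quarter points the scaled energy is about \<open>n^3/12\<close>, half of the
  leading term on the right. This gap absorbs all rounding effects of \<open>n div 4\<close> once
  \<open>n \<ge> 40\<close>.\<close>

lemma energy_quarter_pair_less:
  assumes n: "n \<ge> 40"
  shows "(real n)\<^sup>2 * energy n {n div 4, n - 1 - n div 4} < (real n - 1) ^ 3 / 6"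
proof -
  define a where "a = n div 4"
  define r where "r = n mod 4"
  have nr: "n = 4 * a + r" "r < 4" by (simp_all add: a_def r_def)
  have a: "a \<ge> 10" using n by (simp add: a_def)
  \<comment> \<open>The middle sum is a difference of two initial sums, each with a closed
    form.\<close>
  have "{..n - 1 - a} = {..a} \<union> {a<..n - 1 - a}" using nr a by auto
  then have "(\<Sum>m\<le>n - 1 - a. (real n - 2 * real m)\<^sup>2) =
      (\<Sum>m\<le>a. (real n - 2 * real m)\<^sup>2) + (\<Sum>m\<in>{a<..n - 1 - a}. (real n - 2 * real m)\<^sup>2)"
    by (simp add: sum.union_disjoint disjoint_iff)
  moreover have "real (n - 1 - a) = real n - 1 - real a" using nr a by (simp add: of_nat_diff)
  moreover have "(real n)\<^sup>2 * energy n {a, n - 1 - a} = 4 * real a * (real a + 1) * (2 * real a + 1) / 3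
    + (\<Sum>m\<in>{a<..n - 1 - a}. (real n - 2 * real m)\<^sup>2)"
    using nr a by (intro energy_pair) auto
  ultimately have E: "(real n)\<^sup>2 * energy n {a, n - 1 - a} = 4 * real a * (real a + 1) * (2 * real a + 1) / 3
      + ((real n - real a) * (real n)\<^sup>2 - 2 * real n * (real n - 1 - real a) * (real n - real a)
        + 2 * (real n - 1 - real a) * (real n - real a) * (2 * (real n - real a) - 1) / 3)
      - ((real a + 1) * (real n)\<^sup>2 - 2 * real n * real a * (real a + 1)
        + 2 * real a * (real a + 1) * (2 * real a + 1) / 3)"
    unfolding sum_shifted_squares_atMost by (simp add: algebra_simps)
  define x where "x = real a"
  define \<rho> where "\<rho> = real r"
  have x: "x \<ge> 10" using a by (simp add: x_def)
  have nx: "real n = 4 * x + \<rho>" by (simp add: nr(1) x_def \<rho>_def)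
  \<comment> \<open>Substituting \<open>n = 4 x + \<rho>\<close> leaves a cubic in \<open>x\<close>
    with leading coefficient \<open>32/6\<close>; for \<open>x \<ge> 10\<close> and each residue
    \<rho> it dominates the lower terms.\<close>
  have diff: "(real n - 1) ^ 3 / 6 - (real n)\<^sup>2 * energy n {a, n - 1 - a} =
    (32 * (x * (x * x)) + 24 * (\<rho> - 2) * (x * x) - 4 * x + (\<rho> - 1) ^ 3 - 2 * \<rho> * (\<rho> - 1) * (\<rho> - 2)) / 6"
    unfolding E unfolding x_def[symmetric] nx
    by (simp add: power2_eq_square power3_eq_cube field_simps)
  have "x * x \<ge> 10 * x" using x by simp
  moreover have "x * (x * x) \<ge> 10 * (x * x)" using x by (intro mult_right_mono) auto
  moreover have "24 * (\<rho> - 2) * (x * x) \<ge> - 48 * (x * x)"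
    by (intro mult_right_mono) (auto simp: \<rho>_def)
  moreover have "(\<rho> - 1) ^ 3 - 2 * \<rho> * (\<rho> - 1) * (\<rho> - 2) \<ge> - 4"
  proof -
    have "r = 0 \<or> r = 1 \<or> r = 2 \<or> r = 3" using nr(2) by auto
    then show ?thesis by (auto simp: \<rho>_def)
  qed
  ultimately have "32 * (x * (x * x)) + 24 * (\<rho> - 2) * (x * x) - 4 * x
      + (\<rho> - 1) ^ 3 - 2 * \<rho> * (\<rho> - 1) * (\<rho> - 2) > 0"
    using x by linarith
  then have "(real n - 1) ^ 3 / 6 - (real n)\<^sup>2 * energy n {a, n - 1 - a} > 0"
    unfolding diff by simp
  then show ?thesis by (simp add: a_def)
qed

theorem theorem6:
  "\<exists>N. \<forall>n\<ge>N. \<exists>T\<^sub>1 T\<^sub>2.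
     second_order_expansion (lambda_min n 1) T\<^sub>1 \<and>
     second_order_expansion (lambda_min n 2) T\<^sub>2 \<and>
     (\<forall>\<^sub>F \<epsilon> in at_right 0. poly T\<^sub>2 \<epsilon> > 2 * poly T\<^sub>1 \<epsilon>)"
proof (intro exI[of _ "40::nat"] allI impI)
  fix n :: nat assume n: "n \<ge> 40"
  define M where "M k = Max ((\<lambda>S. - energy n S / real n) ` {S. S \<subseteq> {..<n} \<and> card S = k})" for k
  have "finite {S. S \<subseteq> {..<n} \<and> card S = 1}" by simp
  moreover have "{0} \<in> {S. S \<subseteq> {..<n} \<and> card S = 1}" using n by auto
  ultimately have "M 1 \<in> (\<lambda>S. - energy n S / real n) ` {S. S \<subseteq> {..<n} \<and> card S = 1}"
    unfolding M_def by (intro Max_in) blast+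
  then obtain s where s: "s < n" "M 1 = - energy n {s} / real n"
    by (auto simp: card_1_singleton_iff)
  \<comment> \<open>An explicit competitor suffices for \<open>k = 2\<close>, as the maximum
    \<open>M 2\<close> can only be larger; for \<open>k = 1\<close> the lower bound covers the
    optimal \<open>s\<close>.\<close>
  define P where "P = {n div 4, n - 1 - n div 4}"
  have "n div 4 \<noteq> n - 1 - n div 4" using n by linarith
  then have "P \<in> {S. S \<subseteq> {..<n} \<and> card S = 2}" using n by (auto simp: P_def)
  then have "- energy n P / real n \<le> M 2" unfolding M_def by (intro Max_ge) auto
  moreover have "energy n P < 2 * energy n {s}"
  proof -
    have "(real n)\<^sup>2 * energy n P < (real n)\<^sup>2 * (2 * energy n {s})"
      using energy_quarter_pair_less[OF n] energy_singleton_ge[OF s(1)] unfolding P_def by linarith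
    then show ?thesis using n by (simp add: mult_less_cancel_left)
  qed
  then have "2 * (- energy n {s} / real n) < - energy n P / real n"
    using n by (simp add: field_simps)
  ultimately have M: "2 * M 1 < M 2" unfolding s(2) by linarith
  \<comment> \<open>The linear terms \<open>2/n\<close> and \<open>2 (1/n)\<close> cancel, leaving
    the comparison of \<open>M 2\<close> with \<open>2 M 1\<close>.\<close>
  have "\<forall>\<^sub>F \<epsilon> in at_right 0. poly [:0, 2 / real n, M 2:] \<epsilon> > 2 * poly [:0, 1 / real n, M 1:] \<epsilon>"
    using eventually_at_right_less[of 0]
  proof eventually_elim
    case (elim \<epsilon>)
    then have "\<epsilon>\<^sup>2 * (2 * M 1) < \<epsilon>\<^sup>2 * M 2" using M by (intro mult_strict_left_mono) auto
    then show ?case by (simp add: algebra_simps power2_eq_square)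
  qed
  moreover have "second_order_expansion (lambda_min n 1) [:0, 1 / real n, M 1:]"
    "second_order_expansion (lambda_min n 2) [:0, 2 / real n, M 2:]"
    using lambda_min_expansion[of n 1] lambda_min_expansion[of n 2] n by (simp_all add: M_def)
  ultimately show "\<exists>T\<^sub>1 T\<^sub>2. second_order_expansion (lambda_min n 1) T\<^sub>1 \<and>
     second_order_expansion (lambda_min n 2) T\<^sub>2 \<and>
     (\<forall>\<^sub>F \<epsilon> in at_right 0. poly T\<^sub>2 \<epsilon> > 2 * poly T\<^sub>1 \<epsilon>)"
    by blast
qed

end
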